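(* Let $H_1\subseteq H_2$ and $K_1\subseteq K_2$ be subgroups of a finite group $G$ and $g\in G'$. Then $$\Pr\nolimits_g(H_1,K_1)\le|H_2:H_1||K_2:K_1|\Pr\nolimits_g(H_2,K_2)$$ with equality if and only if all of the following hold: - $g^{-1}x\notin\operatorname{Cl}_{K_2}(x)$ for all $x\in H_2-H_1$; - $g^{-1}x\notin\operatorname{Cl}_{K_2}(x)-\operatorname{Cl}_{K_1}(x)$ for all $x\in H_1$; - $C_{K_1}(x)=C_{K_2}(x)$ for all $x\in H_1$ with $g^{-1}x\in\operatorname{Cl}_{K_1}(x)$. In particular, for $g=1$, the condition for equality reduces to $H_1=H_2$ and $K_1=K_2$.
   Context: $G'$ is the commutator subgroup; $[x,y]=xyx^{-1}y^{-1}$; for subgroups $H,K$ of $G$, $\Pr_g(H,K)=|\{(x,y)\in H\times K:[x,y]=g\}|/(|H||K|)$. For $x\in G$, $C_K(x)=\{y\in K:xy=yx\}$ and $\operatorname{Cl}_K(x)=\{yxy^{-1}:y\in K\}$. $A-B$ denotes set difference. *)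

theory Defs
  imports "HOL-Algebra.Algebra" Complex_Main
begin

definition commutator :: "('a, 'b) monoid_scheme \<Rightarrow> 'a \<Rightarrow> 'a \<Rightarrow> 'a" where
  "commutator G x y = x \<otimes>\<^bsub>G\<^esub> y \<otimes>\<^bsub>G\<^esub> inv\<^bsub>G\<^esub> x \<otimes>\<^bsub>G\<^esub> inv\<^bsub>G\<^esub> y"

definition Pr_comm :: "('a, 'b) monoid_scheme \<Rightarrow> 'a \<Rightarrow> 'a set \<Rightarrow> 'a set \<Rightarrow> real" where
  "Pr_comm G g H K =
     real (card {(x, y) \<in> H \<times> K. commutator G x y = g}) / (real (card H) * real (card K))"

definition centralizer_in :: "('a, 'b) monoid_scheme \<Rightarrow> 'a set \<Rightarrow> 'a \<Rightarrow> 'a set" where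
  "centralizer_in G K x = {y \<in> K. x \<otimes>\<^bsub>G\<^esub> y = y \<otimes>\<^bsub>G\<^esub> x}"

definition conj_class_in :: "('a, 'b) monoid_scheme \<Rightarrow> 'a set \<Rightarrow> 'a \<Rightarrow> 'a set" where
  "conj_class_in G K x = {y \<otimes>\<^bsub>G\<^esub> x \<otimes>\<^bsub>G\<^esub> inv\<^bsub>G\<^esub> y | y. y \<in> K}"

(* The index of the subgroup H in the subgroup L of G, as the number of cosets H #> x with x in L. *)
definition subgroup_index :: "('a, 'b) monoid_scheme \<Rightarrow> 'a set \<Rightarrow> 'a set \<Rightarrow> nat" where
  "subgroup_index G L H = card (rcosets\<^bsub>G\<lparr>carrier := L\<rparr>\<^esub> H)"

definition Pr_equality_cond ::
  "('a, 'b) monoid_scheme \<Rightarrow> 'a \<Rightarrow> 'a set \<Rightarrow> 'a set \<Rightarrow> 'a set \<Rightarrow> 'a set \<Rightarrow> bool" where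
  "Pr_equality_cond G g H1 H2 K1 K2 \<longleftrightarrow>
     (\<forall>x \<in> H2 - H1. inv\<^bsub>G\<^esub> g \<otimes>\<^bsub>G\<^esub> x \<notin> conj_class_in G K2 x) \<and>
     (\<forall>x \<in> H1. inv\<^bsub>G\<^esub> g \<otimes>\<^bsub>G\<^esub> x \<notin> conj_class_in G K2 x - conj_class_in G K1 x) \<and>
     (\<forall>x \<in> H1. inv\<^bsub>G\<^esub> g \<otimes>\<^bsub>G\<^esub> x \<in> conj_class_in G K1 x \<longrightarrow>
        centralizer_in G K1 x = centralizer_in G K2 x)"

end

theory Submission
  imports Defs
begin

text \<open>
  Let \<open>S\<^sub>i\<close> be the set of pairs \<open>(x, y) \<in> H\<^sub>i \<times> K\<^sub>i\<close> with \<open>[x, y] = g\<close>. Clearing denominators by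
  Lagrange's theorem turns the inequality into \<open>|S\<^sub>1| \<le> |S\<^sub>2|\<close> (\<open>index_times_Pr_comm\<close>), which holds
  because \<open>S\<^sub>1 \<subseteq> S\<^sub>2\<close>; by finiteness equality holds exactly when \<open>S\<^sub>1 = S\<^sub>2\<close>.

  Now \<open>[x, y] = g\<close> is equivalent to \<open>y x y\<inverse> = g\<inverse> x\<close>, so for fixed \<open>x\<close> there is a solution \<open>y \<in> K\<close> if
  and only if \<open>g\<inverse> x\<close> lies in the \<open>K\<close>-class of \<open>x\<close>, and the solutions then form a left coset of the
  centralizer of \<open>x\<close> in \<open>K\<close>. The three conditions say that no \<open>x\<close> outside \<open>H\<^sub>1\<close> has a solution in
  \<open>K\<^sub>2\<close>, that every \<open>x \<in> H\<^sub>1\<close> with a solution in \<open>K\<^sub>2\<close> has one in \<open>K\<^sub>1\<close>, and that in this case the two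
  cosets of solutions agree; together they amount to \<open>S\<^sub>1 = S\<^sub>2\<close>
  (\<open>Pr_equality_cond_iff_commutator_pairs_eq\<close>). For \<open>g = 1\<close> the pairs \<open>(x, 1)\<close> and \<open>(1, y)\<close> are
  solutions, which forces \<open>H\<^sub>1 = H\<^sub>2\<close> and \<open>K\<^sub>1 = K\<^sub>2\<close>.
\<close>

text \<open>The set of pairs counted by the numerator of \<open>Pr_comm G g H K\<close>.\<close>

definition commutator_pairs :: "('a, 'b) monoid_scheme \<Rightarrow> 'a \<Rightarrow> 'a set \<Rightarrow> 'a set \<Rightarrow> ('a \<times> 'a) set" where
  "commutator_pairs G g H K = {(x, y) \<in> H \<times> K. commutator G x y = g}"

lemma (in group) commutator_eq_iff_conj_eq:
  assumes "x \<in> carrier G" "y \<in> carrier G" "g \<in> carrier G"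
  shows "commutator G x y = g \<longleftrightarrow> y \<otimes> x \<otimes> inv y = inv g \<otimes> x"
proof -
  have "commutator G x y = x \<otimes> inv (y \<otimes> x \<otimes> inv y)"
    using assms by (simp add: commutator_def inv_mult_group m_assoc)
  moreover have "x \<otimes> inv c = g \<longleftrightarrow> c = inv g \<otimes> x" if "c \<in> carrier G" for c
    using assms that inv_solve_right'[of g x c] inv_solve_left[of c g x] by simp
  ultimately show ?thesis
    using assms by simp
qed

text \<open>Two elements conjugate \<open>x\<close> to the same element if and only if they lie in the same left coset of
  the centralizer of \<open>x\<close>.\<close>

lemma (in group) inv_mult_commutes_iff_conj_eq:
  assumes "x \<in> carrier G" "y \<in> carrier G" "z \<in> carrier G"
  shows "x \<otimes> (inv y \<otimes> z) = (inv y \<otimes> z) \<otimes> x \<longleftrightarrow> z \<otimes> x \<otimes> inv z = y \<otimes> x \<otimes> inv y"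
proof -
  have "x \<otimes> (inv y \<otimes> z) = (inv y \<otimes> z) \<otimes> x \<longleftrightarrow> x \<otimes> inv y \<otimes> z = inv y \<otimes> (z \<otimes> x)"
    using assms by (simp add: m_assoc)
  also have "\<dots> \<longleftrightarrow> y \<otimes> (x \<otimes> inv y \<otimes> z) = z \<otimes> x"
    using assms inv_solve_left[of "x \<otimes> inv y \<otimes> z" y "z \<otimes> x"]
    by auto
  also have "\<dots> \<longleftrightarrow> (y \<otimes> x \<otimes> inv y) \<otimes> z = z \<otimes> x"
    using assms by (simp add: m_assoc)
  also have "\<dots> \<longleftrightarrow> z \<otimes> x \<otimes> inv z = y \<otimes> x \<otimes> inv y"
    using assms inv_solve_right'[of "y \<otimes> x \<otimes> inv y" "z \<otimes> x" z]
    by auto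
  finally show ?thesis .
qed

lemma (in group) subgroup_index_times_card:
  assumes "subgroup H G" "subgroup L G" "H \<subseteq> L"
  shows "subgroup_index G L H * card H = card L"
proof -
  interpret L: group "G\<lparr>carrier := L\<rparr>"
    using assms(2) by (rule subgroup_imp_group)
  have "subgroup H (G\<lparr>carrier := L\<rparr>)"
    using assms by (simp add: subgroup_incl)
  from L.lagrange[OF this] show ?thesis
    by (simp add: subgroup_index_def order_def)
qed

lemma (in group) index_times_Pr_comm:
  assumes fin: "finite (carrier G)"
    and H: "subgroup H1 G" "subgroup H2 G" "H1 \<subseteq> H2"
    and K: "subgroup K1 G" "subgroup K2 G" "K1 \<subseteq> K2"
  shows "real (subgroup_index G H2 H1) * real (subgroup_index G K2 K1) * Pr_comm G g H2 K2
    = real (card (commutator_pairs G g H2 K2)) / (real (card H1) * real (card K1))"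
proof -
  have pos: "card L > 0" if "subgroup L G" for L
    using subgroup.finite_imp_card_positive[OF that fin] .
  have "real (card H2) = real (subgroup_index G H2 H1) * real (card H1)"
    and "real (card K2) = real (subgroup_index G K2 K1) * real (card K1)"
    using subgroup_index_times_card[OF H] subgroup_index_times_card[OF K]
    by (metis of_nat_mult)+
  moreover have "real (card H2) > 0" "real (card K2) > 0"
    using pos H K by simp_all
  ultimately show ?thesis
    by (simp add: Pr_comm_def commutator_pairs_def field_simps zero_less_mult_iff)
qed

lemma (in group) Pr_equality_cond_iff_commutator_pairs_eq:
  assumes H: "subgroup H1 G" "subgroup H2 G" "H1 \<subseteq> H2"
    and K: "subgroup K1 G" "subgroup K2 G" "K1 \<subseteq> K2"
    and g: "g \<in> carrier G"
  shows "Pr_equality_cond G g H1 H2 K1 K2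
    \<longleftrightarrow> commutator_pairs G g H1 K1 = commutator_pairs G g H2 K2"
proof -
  interpret K1: subgroup K1 G by (rule K(1))
  have Hc: "x \<in> carrier G" if "x \<in> H2" for x
    using subgroup.mem_carrier[OF H(2) that] .
  have Kc: "y \<in> carrier G" if "y \<in> K2" for y
    using subgroup.mem_carrier[OF K(2) that] .
  have pair_iff: "(x, y) \<in> commutator_pairs G g H K
      \<longleftrightarrow> x \<in> H \<and> y \<in> K \<and> y \<otimes> x \<otimes> inv y = inv g \<otimes> x"
    if "H \<subseteq> H2" "K \<subseteq> K2" for x y H K
    using that Hc[of x] Kc[of y] commutator_eq_iff_conj_eq[of x y g] g
    unfolding commutator_pairs_def by blast
  show ?thesis
  proof
    assume cond: "Pr_equality_cond G g H1 H2 K1 K2"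
    have "(x, y) \<in> commutator_pairs G g H1 K1" if xy: "(x, y) \<in> commutator_pairs G g H2 K2" for x y
    proof -
      from xy have x2: "x \<in> H2" and y2: "y \<in> K2" and eq: "y \<otimes> x \<otimes> inv y = inv g \<otimes> x"
        by (simp_all add: pair_iff)
      have class2: "inv g \<otimes> x \<in> conj_class_in G K2 x"
        using y2 eq[symmetric] by (auto simp: conj_class_in_def)
      then have x1: "x \<in> H1"
        using cond x2 by (auto simp: Pr_equality_cond_def)
      then have class1: "inv g \<otimes> x \<in> conj_class_in G K1 x"
        using cond class2 by (auto simp: Pr_equality_cond_def)
      then obtain z where z: "z \<in> K1" "inv g \<otimes> x = z \<otimes> x \<otimes> inv z"
        by (auto simp: conj_class_in_def)
      \<comment> \<open>Both \<open>y\<close> and \<open>z\<close> conjugate \<open>x\<close> to \<open>g\<inverse> x\<close>, so they differ by an element centralizing \<open>x\<close>.\<close>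
      have "inv z \<otimes> y \<in> centralizer_in G K2 x"
        using inv_mult_commutes_iff_conj_eq[of x z y] x2 y2 z eq Hc Kc K
        by (auto simp: centralizer_in_def subgroup.m_closed subgroup.m_inv_closed)
      also have "\<dots> = centralizer_in G K1 x"
        using cond x1 class1 by (auto simp: Pr_equality_cond_def)
      finally have "z \<otimes> (inv z \<otimes> y) \<in> K1"
        using z by (auto simp: centralizer_in_def)
      then have "y \<in> K1"
        using z y2 Kc by (simp add: m_assoc[symmetric])
      then show ?thesis
        using x1 eq H K by (simp add: pair_iff)
    qed
    moreover have "commutator_pairs G g H1 K1 \<subseteq> commutator_pairs G g H2 K2"
      using H K by (auto simp: commutator_pairs_def)
    ultimately show "commutator_pairs G g H1 K1 = commutator_pairs G g H2 K2"
      by auto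
  next
    assume eq: "commutator_pairs G g H1 K1 = commutator_pairs G g H2 K2"
    have solution: "x \<in> H1 \<and> y \<in> K1"
      if "x \<in> H2" "y \<in> K2" "inv g \<otimes> x = y \<otimes> x \<otimes> inv y" for x y
    proof -
      have "(x, y) \<in> commutator_pairs G g H2 K2"
        using that by (simp add: pair_iff)
      then show ?thesis
        unfolding eq[symmetric] by (simp add: commutator_pairs_def)
    qed
    \<comment> \<open>If \<open>z\<close> is a solution for \<open>x\<close> and \<open>c\<close> centralizes \<open>x\<close>, then \<open>z c\<close> is again a solution.\<close>
    have "c \<in> K1"
      if x: "x \<in> H1" and z: "z \<in> K1" "inv g \<otimes> x = z \<otimes> x \<otimes> inv z"
        and c: "c \<in> K2" "x \<otimes> c = c \<otimes> x" for x z c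
    proof -
      have carr: "x \<in> carrier G" "z \<in> carrier G" "c \<in> carrier G" "z \<in> K2"
        using x z c H K Hc Kc by auto
      have cancel: "inv z \<otimes> (z \<otimes> c) = c"
        using carr by (simp add: m_assoc[symmetric])
      then have "(z \<otimes> c) \<otimes> x \<otimes> inv (z \<otimes> c) = z \<otimes> x \<otimes> inv z"
        using inv_mult_commutes_iff_conj_eq[of x z "z \<otimes> c"] carr c by simp
      then have "z \<otimes> c \<in> K1"
        using solution[of x "z \<otimes> c"] x z c carr H K by (auto simp: subgroup.m_closed)
      then have "inv z \<otimes> (z \<otimes> c) \<in> K1"
        using z by simp
      then show ?thesis
        using cancel by simp
    qed
    then have "centralizer_in G K1 x = centralizer_in G K2 x"
      if "x \<in> H1" "inv g \<otimes> x \<in> conj_class_in G K1 x" for x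
      using that K by (auto simp: centralizer_in_def conj_class_in_def)
    moreover have "inv g \<otimes> x \<notin> conj_class_in G K2 x" if "x \<in> H2 - H1" for x
      using that solution by (auto simp: conj_class_in_def)
    moreover have "inv g \<otimes> x \<notin> conj_class_in G K2 x - conj_class_in G K1 x" if "x \<in> H1" for x
      using that solution H by (auto simp: conj_class_in_def)
    ultimately show "Pr_equality_cond G g H1 H2 K1 K2"
      unfolding Pr_equality_cond_def by blast
  qed
qed

lemma (in group) commutator_pairs_one_eq_iff:
  assumes H: "subgroup H1 G" "subgroup H2 G" "H1 \<subseteq> H2"
    and K: "subgroup K1 G" "subgroup K2 G" "K1 \<subseteq> K2"
  shows "commutator_pairs G \<one> H1 K1 = commutator_pairs G \<one> H2 K2 \<longleftrightarrow> H1 = H2 \<and> K1 = K2"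
proof
  assume eq: "commutator_pairs G \<one> H1 K1 = commutator_pairs G \<one> H2 K2"
  have "(x, \<one>) \<in> commutator_pairs G \<one> H2 K2" if "x \<in> H2" for x
    using that subgroup.mem_carrier[OF H(2)] subgroup.one_closed[OF K(2)]
    by (simp add: commutator_pairs_def commutator_def)
  then have "H2 \<subseteq> H1"
    unfolding eq[symmetric] by (auto simp: commutator_pairs_def)
  moreover have "(\<one>, y) \<in> commutator_pairs G \<one> H2 K2" if "y \<in> K2" for y
    using that subgroup.mem_carrier[OF K(2)] subgroup.one_closed[OF H(2)]
    by (simp add: commutator_pairs_def commutator_def)
  then have "K2 \<subseteq> K1"
    unfolding eq[symmetric] by (auto simp: commutator_pairs_def)
  ultimately show "H1 = H2 \<and> K1 = K2"
    using H K by blast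
qed simp

theorem proposition5p2p6:
  fixes G :: "('a, 'b) monoid_scheme" and H1 H2 K1 K2 :: "'a set" and g :: 'a
  assumes "group G" and "finite (carrier G)"
    and "subgroup H1 G" and "subgroup H2 G" and "H1 \<subseteq> H2"
    and "subgroup K1 G" and "subgroup K2 G" and "K1 \<subseteq> K2"
    and "g \<in> derived G (carrier G)"
  shows "Pr_comm G g H1 K1
           \<le> real (subgroup_index G H2 H1) * real (subgroup_index G K2 K1) * Pr_comm G g H2 K2
       \<and> (Pr_comm G g H1 K1
           = real (subgroup_index G H2 H1) * real (subgroup_index G K2 K1) * Pr_comm G g H2 K2
          \<longleftrightarrow> Pr_equality_cond G g H1 H2 K1 K2)
       \<and> (g = \<one>\<^bsub>G\<^esub> \<longrightarrow>
            (Pr_equality_cond G g H1 H2 K1 K2 \<longleftrightarrow> H1 = H2 \<and> K1 = K2) \<and>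
            (Pr_comm G g H1 K1
               = real (subgroup_index G H2 H1) * real (subgroup_index G K2 K1) * Pr_comm G g H2 K2
             \<longleftrightarrow> H1 = H2 \<and> K1 = K2))"
proof -
  interpret group G by (rule assms(1))
  let ?S1 = "commutator_pairs G g H1 K1" and ?S2 = "commutator_pairs G g H2 K2"
  let ?d = "real (card H1) * real (card K1)"
  let ?R = "real (subgroup_index G H2 H1) * real (subgroup_index G K2 K1) * Pr_comm G g H2 K2"
  have g: "g \<in> carrier G"
    using assms(9) derived_in_carrier[of "carrier G"] by blast
  have fin: "finite ?S2"
  proof (rule finite_subset)
    show "?S2 \<subseteq> H2 \<times> K2"
      by (auto simp: commutator_pairs_def)
    show "finite (H2 \<times> K2)"
      using assms(2) subgroup.subset[OF assms(4)] subgroup.subset[OF assms(7)]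
      by (blast intro: finite_subset finite_cartesian_product)
  qed
  have sub: "?S1 \<subseteq> ?S2"
    using assms(5,8) by (auto simp: commutator_pairs_def)
  have d: "?d > 0"
    using subgroup.finite_imp_card_positive[OF assms(3,2)]
      subgroup.finite_imp_card_positive[OF assms(6,2)] by simp
  have L: "Pr_comm G g H1 K1 = real (card ?S1) / ?d"
    by (simp add: Pr_comm_def commutator_pairs_def)
  have R: "?R = real (card ?S2) / ?d"
    by (rule index_times_Pr_comm[OF assms(2-8)])
  have le: "Pr_comm G g H1 K1 \<le> ?R"
    unfolding L R using card_mono[OF fin sub] by (intro divide_right_mono) auto
  have "Pr_comm G g H1 K1 = ?R \<longleftrightarrow> card ?S1 = card ?S2"
    unfolding L R using d by (auto simp: zero_less_mult_iff)
  also have "\<dots> \<longleftrightarrow> ?S1 = ?S2"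
    using card_subset_eq[OF fin sub] by auto
  finally have eq: "Pr_comm G g H1 K1 = ?R \<longleftrightarrow> ?S1 = ?S2" .
  have cond: "Pr_equality_cond G g H1 H2 K1 K2 \<longleftrightarrow> ?S1 = ?S2"
    by (rule Pr_equality_cond_iff_commutator_pairs_eq[OF assms(3-8) g])
  have one: "?S1 = ?S2 \<longleftrightarrow> H1 = H2 \<and> K1 = K2" if "g = \<one>\<^bsub>G\<^esub>"
    unfolding that by (rule commutator_pairs_one_eq_iff[OF assms(3-8)])
  show ?thesis
    using le eq cond one by blast
qed

end
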